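(* Let $A$ be a power-associative algebra over a field $F$ which is algebraic (every element of $A$ satisfies a nonzero polynomial equation over $F$) and has no zero divisors. If $R$ is a Rota–Baxter operator of weight zero on $A$, then $R=0$.
   Context: An algebra is a vector space with a bilinear product, not necessarily associative. A linear operator $R\colon A\to A$ is a Rota–Baxter operator (RB-operator) of weight $\lambda\in F$ if $R(x)R(y)=R(R(x)y+xR(y)+\lambda xy)$ for all $x,y\in A$. An algebra is power-associative if every single element generates an associative subalgebra. *)

theory Defs
  imports Main "HOL-Computational_Algebra.Polynomial"
begin

definition bilinear_prod :: "('f::field \<Rightarrow> 'a::ab_group_add \<Rightarrow> 'a) \<Rightarrow> ('a \<Rightarrow> 'a \<Rightarrow> 'a) \<Rightarrow> bool" where
  "bilinear_prod sc mul \<longleftrightarrow>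
     (\<forall>x y z. mul (x + y) z = mul x z + mul y z) \<and>
     (\<forall>x y z. mul x (y + z) = mul x y + mul x z) \<and>
     (\<forall>c x y. mul (sc c x) y = sc c (mul x y)) \<and>
     (\<forall>c x y. mul x (sc c y) = sc c (mul x y))"

definition nonassoc_algebra :: "('f::field \<Rightarrow> 'a::ab_group_add \<Rightarrow> 'a) \<Rightarrow> ('a \<Rightarrow> 'a \<Rightarrow> 'a) \<Rightarrow> bool" where
  "nonassoc_algebra sc mul \<longleftrightarrow> vector_space sc \<and> bilinear_prod sc mul"

definition gen_subalg :: "('f::field \<Rightarrow> 'a::ab_group_add \<Rightarrow> 'a) \<Rightarrow> ('a \<Rightarrow> 'a \<Rightarrow> 'a) \<Rightarrow> 'a \<Rightarrow> 'a set" where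
  "gen_subalg sc mul x =
     \<Inter> {S. x \<in> S \<and> module.subspace sc S \<and> (\<forall>a\<in>S. \<forall>b\<in>S. mul a b \<in> S)}"

definition power_associative :: "('f::field \<Rightarrow> 'a::ab_group_add \<Rightarrow> 'a) \<Rightarrow> ('a \<Rightarrow> 'a \<Rightarrow> 'a) \<Rightarrow> bool" where
  "power_associative sc mul \<longleftrightarrow>
     (\<forall>x. \<forall>a\<in>gen_subalg sc mul x. \<forall>b\<in>gen_subalg sc mul x. \<forall>c\<in>gen_subalg sc mul x.
        mul (mul a b) c = mul a (mul b c))"

text \<open>Powers x^1 = x, x^(n+1) = x * x^n  (napow mul x n = x^(n+1)).\<close>
primrec napow :: "('a \<Rightarrow> 'a \<Rightarrow> 'a) \<Rightarrow> 'a \<Rightarrow> nat \<Rightarrow> 'a" where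
  "napow mul x 0 = x"
| "napow mul x (Suc n) = mul x (napow mul x n)"

text \<open>Evaluation of a polynomial without constant term at x (non-unital algebra):
  sum_{i=1..deg p} coeff p i \<cdot> x^i.\<close>
definition peval :: "('f::field \<Rightarrow> 'a::ab_group_add \<Rightarrow> 'a) \<Rightarrow> ('a \<Rightarrow> 'a \<Rightarrow> 'a) \<Rightarrow> 'f poly \<Rightarrow> 'a \<Rightarrow> 'a" where
  "peval sc mul p x = (\<Sum>i\<in>{1..degree p}. sc (coeff p i) (napow mul x (i - 1)))"

definition algebraic_alg :: "('f::field \<Rightarrow> 'a::ab_group_add \<Rightarrow> 'a) \<Rightarrow> ('a \<Rightarrow> 'a \<Rightarrow> 'a) \<Rightarrow> bool" where
  "algebraic_alg sc mul \<longleftrightarrow>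
     (\<forall>x. \<exists>p. p \<noteq> 0 \<and> coeff p 0 = 0 \<and> peval sc mul p x = 0)"

definition no_zero_divisors_alg :: "('a::ab_group_add \<Rightarrow> 'a \<Rightarrow> 'a) \<Rightarrow> bool" where
  "no_zero_divisors_alg mul \<longleftrightarrow> (\<forall>x y. mul x y = 0 \<longrightarrow> x = 0 \<or> y = 0)"

definition rota_baxter :: "('f::field \<Rightarrow> 'a::ab_group_add \<Rightarrow> 'a) \<Rightarrow> ('a \<Rightarrow> 'a \<Rightarrow> 'a) \<Rightarrow> 'f \<Rightarrow> ('a \<Rightarrow> 'a) \<Rightarrow> bool" where
  "rota_baxter sc mul w R \<longleftrightarrow> Vector_Spaces.linear sc sc R \<and>
     (\<forall>x y. mul (R x) (R y) = R (mul (R x) y + mul x (R y) + sc w (mul x y)))"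

end

theory Submission
  imports Defs
begin

text \<open>If \<open>R x \<noteq> 0\<close>, then \<open>R x\<close> generates a field inside the subalgebra \<open>range R\<close>, whose
  unit is an idempotent \<open>e = R a \<noteq> 0\<close>. Put \<open>S y = e y + y e\<close>. The Rota--Baxter identity
  gives \<open>R (S\<^sup>n a) = e\<close> for all \<open>n\<close>, that is, \<open>R (h(S) a) = h(1) e\<close> for every polynomial \<open>h\<close>.
  Comparing the units of the fields generated by \<open>y\<close> and \<open>e + y\<close> shows that \<open>S\<close> has no
  nonzero fixed point. So it is enough that \<open>h(S) a = 0\<close> for some polynomial \<open>h \<noteq> 0\<close>: powers
  of \<open>S - 1\<close> can be cancelled, and then \<open>h(1) e = 0\<close> with \<open>h(1) \<noteq> 0\<close>.

  If the field has an element outside \<open>{0, 1, -1}\<close>, linearizing \<open>x\<^sup>2 x = x x\<^sup>2\<close>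
  in characteristic 2 gives \<open>S\<^sup>2 = S\<close>, and linearizing \<open>x\<^sup>2 x\<^sup>2 = x (x x\<^sup>2)\<close> otherwise gives
  \<open>S (S - 1) (S - 2) = 0\<close>. Over the field with three elements a weaker linearization still
  gives \<open>(S - 1) (S\<^sup>3 - S) = 0\<close>. Over the field with two elements no polynomial identity
  for \<open>S\<close> is proved; instead, algebraicity gives \<open>z\<^bsup>2^m\<^esup> = z\<close> with \<open>m > 0\<close> for
  \<open>z = S\<^sup>2 a\<close>, and this is converted into \<open>((S + 1)\<^sup>m - 1) S\<^sup>4 a = 0\<close>.\<close>

section \<open>Squaring in characteristic two\<close>

text \<open>Intended instance: \<open>br x y = x y + y x\<close> and \<open>q x = x\<^sup>2\<close> in a power-associative algebra.\<close>

locale char2_squaring =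
  fixes br :: "'a::ab_group_add \<Rightarrow> 'a \<Rightarrow> 'a" and q :: "'a \<Rightarrow> 'a"
  assumes add_self: "x + x = (0::'a)"
    and br_add_left: "br (x + y) w = br x w + br y w"
    and br_commute: "br x y = br y x"
    and br_self: "br x x = 0"
    and q_add: "q (x + y) = q x + q y + br x y"
    and br_q_iter: "br ((q ^^ k) x) x = 0"
begin

lemma add_self_left: "x + (x + y) = (y::'a)"
  by (metis add.assoc add_self add_0)

lemma eq_iff_add_eq_0: "x = y \<longleftrightarrow> x + y = (0::'a)"
  by (metis add_self add_right_cancel)

lemma br_add_right: "br w (x + y) = br w x + br w y"
  by (metis br_add_left br_commute)

lemma br_0_right [simp]: "br x 0 = 0"
  using br_add_right[of x 0 0] by simp

lemma br_0_left [simp]: "br 0 x = 0"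
  by (metis br_commute br_0_right)

lemmas br_additive = br_add_left br_add_right
lemmas sum_normalize = add_self add_self_left add.assoc add.commute add.left_commute

lemma br_q_self: "br (q x) x = 0"
  using br_q_iter[of 1 x] by simp

lemma br_q_q_self: "br (q (q x)) x = 0"
  using br_q_iter[of 2 x] by (simp add: numeral_2_eq_2)

text \<open>The trilinear part of \<open>br (q x) x = 0\<close>, isolated by
  inclusion-exclusion.\<close>

lemma jacobi: "br (br x y) w = br (br x w) y + br x (br y w)"
proof -
  have "br (q (x + y + w)) (x + y + w) + br (q (x + y)) (x + y) + br (q (x + w)) (x + w)
      + br (q (y + w)) (y + w) + br (q x) x + br (q y) y + br (q w) w = 0"
    by (simp add: br_q_self)
  then have "br (br x y) w + (br (br x w) y + br (br y w) x) = 0"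
    by (simp add: q_add br_additive br_commute[of w x] br_commute[of w y] sum_normalize)
  then show ?thesis
    by (metis eq_iff_add_eq_0 br_commute)
qed

text \<open>Homogeneous components of an identity cannot be separated over the field with two
  elements, so \<open>defect\<close> need not vanish there; it is only symmetric and biadditive.\<close>

definition defect :: "'a \<Rightarrow> 'a \<Rightarrow> 'a" where
  "defect x y = br (q x) y + br x (br x y)"

text \<open>Polarizing \<open>br (q x) x = 0\<close> gives the components of degrees (2,1) and (1,2)
  only as a sum; they are these two defects.\<close>

lemma defect_commute: "defect x y = defect y x"
proof -
  have "br (q (x + y)) (x + y) + br (q x) x + br (q y) y = 0"
    by (simp add: br_q_self)
  then have "defect x y + defect y x = 0"
    unfolding defect_def
    by (simp add: q_add br_additive br_commute[of "br x y"] br_commute[of y x] sum_normalize)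
  then show ?thesis
    by (rule iffD2[OF eq_iff_add_eq_0])
qed

lemma defect_add_right: "defect w (x + y) = defect w x + defect w y"
  by (simp add: defect_def br_additive sum_normalize)

lemma defect_add_left: "defect (x + y) w = defect x w + defect y w"
  by (metis defect_add_right defect_commute)

lemmas defect_additive = defect_add_left defect_add_right

lemma defect_q_self: "defect (q x) x = 0"
  by (simp add: defect_def br_q_self br_q_q_self)

lemma defect_jacobi: "defect (br x y) w + defect (br x w) y + defect (br y w) x = 0"
proof -
  have "defect (q (x + y + w)) (x + y + w) + defect (q (x + y)) (x + y) + defect (q (x + w)) (x + w)
      + defect (q (y + w)) (y + w) + defect (q x) x + defect (q y) y + defect (q w) w = 0"
    by (simp add: defect_q_self)
  then show ?thesis
    by (simp add: q_add br_additive defect_additive br_commute[of w x] br_commute[of w y] sum_normalize)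
qed

lemma br_defect_self: "br x (defect x w) = defect x (br x w)"
proof -
  have "br x (br (q x) w) = br (q x) (br x w)"
    using jacobi[of x "q x" w] jacobi[of "q x" x w] br_q_self[of x]
    by (metis add_0 br_0_left br_commute add.right_neutral eq_iff_add_eq_0)
  then show ?thesis
    by (simp add: defect_def br_additive)
qed

lemma br_defect_polarized: "br x (defect y w) + br y (defect x w) = defect x (br y w) + defect y (br x w)"
  using br_defect_self[of "x + y" w] br_defect_self[of x w] br_defect_self[of y w]
  by (simp add: br_additive defect_additive sum_normalize)

end

section \<open>Bracketing with an idempotent\<close>

locale char2_squaring_idem = char2_squaring +
  fixes e assumes q_e: "q e = e"
begin

abbreviation S where "S \<equiv> br e"
abbreviation P where "P x \<equiv> S x + S (S x)"

lemma S_br: "S (br x y) = br (S x) y + br x (S y)"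
  by (metis br_commute jacobi add.commute)

lemma defect_e: "defect e w = P w"
  by (simp add: defect_def q_e)

text \<open>Both sides equal \<open>defect x (S w) + P (br x w)\<close>, by
  \<open>defect_jacobi\<close> and \<open>br_defect_polarized\<close> at \<open>e\<close>.\<close>

lemma defect_S_left: "defect (S x) w = S (defect x w) + br x (P w)"
proof -
  have "S (defect x w) + br x (P w) = defect x (S w) + P (br x w)"
    using br_defect_polarized[of x e w] by (simp add: defect_e add.commute)
  moreover have "defect (S x) w + defect (S w) x + P (br x w) = 0"
    using defect_jacobi[of e x w] defect_commute[of "br x w" e] by (simp add: defect_e)
  ultimately show ?thesis
    by (metis (no_types) add.assoc eq_iff_add_eq_0 defect_commute)
qed

lemma defect_S_right: "defect x (S w) = S (defect x w) + br (P x) w"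
  by (metis br_commute defect_S_left defect_commute)

text \<open>Compares two expansions of \<open>defect (S x) (S w)\<close>: \<open>S\<close> is pulled
  out of the left or of the right argument first.\<close>

lemma br_SS_S: "br (S (S x)) (S w) = br (S x) (S (S w))"
proof -
  have "S (defect x (S w)) + br x (P (S w)) = S (defect (S x) w) + br (P (S x)) w"
    by (metis defect_S_left defect_S_right)
  then have "(S (defect x (S w)) + br x (P (S w))) + (S (defect (S x) w) + br (P (S x)) w) = 0"
    by (simp only: add_self)
  then have "br (S (S x)) (S w) + br (S x) (S (S w)) = 0"
    by (simp add: defect_S_left defect_S_right br_additive S_br[of "S _" w] S_br[of x "S _"] sum_normalize)
  then show ?thesis
    by (rule iffD2[OF eq_iff_add_eq_0])
qed

lemma S_br_S_S: "S (br (S x) (S w)) = 0"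
  by (simp add: S_br[of "S x"] br_SS_S add_self)

lemma S_q: "S (q y) = P y + br y (S y)"
proof -
  have "P y = br (q y) e + br y (br y e)"
    by (metis defect_e defect_commute defect_def)
  then show ?thesis
    by (metis add.assoc add.commute add_self_left br_commute)
qed

text \<open>Since \<open>S\<close> kills brackets of elements of its image, applying this to the bracket
  of \<open>S (q g)\<close> with \<open>S w\<close> isolates the summand \<open>br g (S g)\<close> of \<open>S (q g)\<close>.\<close>

lemma br_br_S_SS:
  assumes "S (br g (S g)) = 0"
  shows "br (br g (S g)) (S (S w)) = 0"
proof -
  have "S (br (S (q g)) (S w)) = S (br (P g) (S w)) + S (br (br g (S g)) (S w))"
    by (simp only: S_q br_additive)
  moreover have "S (br (P g) (S w)) = 0"
    by (simp add: br_additive S_br_S_S)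
  moreover have "S (br (S (q g)) (S w)) = 0"
    by (rule S_br_S_S)
  ultimately show ?thesis
    using assms by (simp add: S_br[of "br g (S g)"])
qed

text \<open>All \<open>h(S) z\<close> with \<open>h\<close> over the two-element field, in
  particular the iterates of \<open>S + 1\<close> at \<open>z\<close>.\<close>

inductive_set orbit for z where
  base: "z \<in> orbit z"
| step: "u \<in> orbit z \<Longrightarrow> S u \<in> orbit z"
| sum: "u \<in> orbit z \<Longrightarrow> v \<in> orbit z \<Longrightarrow> u + v \<in> orbit z"

lemma orbit_S_S_image: "u \<in> orbit (S (S x)) \<Longrightarrow> \<exists>t. u = S (S t)"
  by (induction rule: orbit.induct) (auto simp: br_add_right[symmetric])

text \<open>Up to an error term \<open>c\<close> killed by \<open>S\<close>, the operator \<open>S\<close> sees the Frobenius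
  iterates of \<open>z\<close> as iterates of the additive map \<open>S + 1\<close>.\<close>

lemma S_iter_q:
  assumes z: "z = S (S y)"
  shows "\<exists>c. S ((q ^^ k) z) = S (((\<lambda>x. S x + x) ^^ k) z) + c \<and> S c = 0 \<and> (\<forall>w. br c (S (S w)) = 0)"
proof (induction k)
  case 0
  show ?case by (intro exI[of _ 0]) simp
next
  case (Suc k)
  define g where "g = (q ^^ k) z"
  define u where "u = ((\<lambda>x. S x + x) ^^ k) z"
  obtain c where c: "S g = S u + c" "S c = 0" "\<And>w. br c (S (S w)) = 0"
    using Suc.IH unfolding g_def u_def by blast
  have u: "u \<in> orbit z"
    unfolding u_def by (induction k) (auto intro: orbit.intros)
  have im: "\<exists>t. v = S (S t)" if "v \<in> orbit z" for v
    using that unfolding z by (rule orbit_S_S_image)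
  have cv: "br c v = 0" if "v \<in> orbit z" for v
    using im[OF that] c(3) by auto
  have Sorb: "S (br v w) = 0" if "v \<in> orbit z" "w \<in> orbit z" for v w
    using im[OF that(1)] im[OF that(2)] S_br_S_S by auto
  have gz: "br g z = 0"
    unfolding g_def by (rule br_q_iter)
  have Sgv: "S (br (S g) v) = 0" if "v \<in> orbit z" for v
    by (simp add: c(1) br_additive cv that Sorb u orbit.step)
  \<comment> \<open>If \<open>S\<close> kills \<open>br g v\<close>, then
    \<open>br g (S v) = br (S g) v\<close> as \<open>S\<close> is a derivation, and
    \<open>Sgv\<close> applies. The chain starts at \<open>gz\<close>.\<close>
  have main: "S (br g (S v)) = 0" if "v \<in> orbit z" for v
    using that
  proof (induction rule: orbit.induct)
    case base
    have "br (S g) z + br g (S z) = 0"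
      using S_br[of g z] gz by simp
    then have "br g (S z) = br (S g) z"
      by (metis add.commute eq_iff_add_eq_0)
    then show ?case
      by (simp add: Sgv orbit.base)
  next
    case (step v)
    then have "br (S g) (S v) + br g (S (S v)) = 0"
      using S_br[of g "S v"] by simp
    then have "br g (S (S v)) = br (S g) (S v)"
      by (metis add.commute eq_iff_add_eq_0)
    then show ?case
      using step by (simp add: Sgv orbit.step)
  next
    case (sum v w)
    then show ?case by (simp add: br_additive)
  qed
  \<comment> \<open>The new error made by passing from \<open>g\<close> to \<open>q g\<close>; it
    needs the same two properties as \<open>c\<close>.\<close>
  define n where "n = br g (S g)"
  have "S (br g c) = 0"
    using cv[OF orbit.step[OF u]] by (simp add: S_br[of g] c br_additive br_self br_commute[of "S u" c])
  then have Sn: "S n = 0"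
    by (simp add: n_def c(1) br_add_right main u)
  have nw: "br n (S (S w)) = 0" for w
    using br_br_S_SS Sn unfolding n_def by blast
  have "S (q g) = S (S u + u) + (c + n)"
    by (simp add: S_q c br_additive n_def sum_normalize)
  moreover have "S (c + n) = 0" "\<forall>w. br (c + n) (S (S w)) = 0"
    by (simp_all add: br_additive c Sn nw)
  ultimately show ?case
    unfolding funpow.simps o_def g_def u_def by blast
qed

lemma S_poly_of_periodic:
  assumes "z = S (S y)" "(q ^^ m) z = z"
  shows "S (S (((\<lambda>x. S x + x) ^^ m) z)) = S (S z)"
proof -
  obtain c where "S z = S (((\<lambda>x. S x + x) ^^ m) z) + c" "S c = 0"
    using S_iter_q[OF assms(1), of m] assms(2) by auto
  then show ?thesis by (metis add.right_neutral br_add_right)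
qed

end

section \<open>Multiplication by an idempotent in characteristic other than two\<close>

text \<open>Intended instance: \<open>x \<odot> y = x y + y x\<close>, without the factor one half; this is why
  \<open>e \<odot> e = e + e\<close> for an idempotent \<open>e\<close>.\<close>

locale comm_quartic_algebra = vector_space scale
  for scale :: "'f::field \<Rightarrow> 'a::ab_group_add \<Rightarrow> 'a" +
  fixes prod :: "'a \<Rightarrow> 'a \<Rightarrow> 'a" (infixl "\<odot>" 70) and e :: 'a
  assumes prod_commute: "x \<odot> y = y \<odot> x"
    and prod_add_left: "(x + y) \<odot> w = x \<odot> w + y \<odot> w"
    and prod_scale_left: "scale t x \<odot> y = scale t (x \<odot> y)"
    and quartic: "(x \<odot> x) \<odot> (x \<odot> x) = x \<odot> (x \<odot> (x \<odot> x))"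
    and e_e: "e \<odot> e = e + e"
    and two_neq_0: "(1 + 1 :: 'f) \<noteq> 0"
begin

abbreviation S where "S x \<equiv> e \<odot> x"

lemma prod_add_right: "w \<odot> (x + y) = w \<odot> x + w \<odot> y"
  by (metis prod_add_left prod_commute)

lemma prod_scale_right: "y \<odot> scale t x = scale t (y \<odot> x)"
  by (metis prod_scale_left prod_commute)

lemma prod_minus_left: "(- x) \<odot> y = - (x \<odot> y)"
  using prod_scale_left[of "-1" x y] by simp

lemma prod_minus_right: "y \<odot> (- x) = - (y \<odot> x)"
  using prod_scale_right[of y "-1" x] by simp

lemma prod_diff_left: "(x - y) \<odot> w = x \<odot> w - y \<odot> w"
  using prod_add_left[of x "- y" w] by (simp add: prod_minus_left)

lemma prod_diff_right: "w \<odot> (x - y) = w \<odot> x - w \<odot> y"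
  by (metis prod_diff_left prod_commute)

lemmas prod_additive = prod_add_left prod_add_right prod_minus_left prod_minus_right
  prod_diff_left prod_diff_right

lemma double_eq_0: "x + x = 0 \<Longrightarrow> x = (0::'a)"
  using two_neq_0 scale_left_distrib[of 1 1 x] by simp

text \<open>Multilinear form of \<open>quartic\<close>; \<open>M31 x y\<close> and
  \<open>M22 x y\<close> below are its components of degrees (3,1) and (2,2) in \<open>x\<close> and
  \<open>y\<close>.\<close>

definition M where "M a b c d = (a \<odot> b) \<odot> (c \<odot> d) - a \<odot> (b \<odot> (c \<odot> d))"

definition M31 where "M31 x y = M y x x x + M x y x x + M x x y x + M x x x y"

definition M22 where
  "M22 x y = M x x y y + M x y x y + M x y y x + M y x x y + M y x y x + M y y x x"

lemma M_add:
  "M (a + a') b c d = M a b c d + M a' b c d"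
  "M a (b + b') c d = M a b c d + M a b' c d"
  "M a b (c + c') d = M a b c d + M a b c' d"
  "M a b c (d + d') = M a b c d + M a b c d'"
  by (simp_all add: M_def prod_additive)

lemma M_scale:
  "M (scale t a) b c d = scale t (M a b c d)"
  "M a (scale t b) c d = scale t (M a b c d)"
  "M a b (scale t c) d = scale t (M a b c d)"
  "M a b c (scale t d) = scale t (M a b c d)"
  by (simp_all add: M_def prod_scale_left prod_scale_right scale_right_diff_distrib)

lemma M_diag: "M x x x x = 0"
  by (simp add: M_def quartic)

lemma M_polarized: "M31 x y + M22 x y + M31 y x = 0"
proof -
  have "M (x + y) (x + y) (x + y) (x + y) = M x x x x + M31 x y + M22 x y + M31 y x + M y y y y"
    by (simp only: M_add M31_def M22_def ac_simps)
  then show ?thesis by (simp add: M_diag)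
qed

lemma M_polarized_scale:
  "scale t (M31 x y) + scale (t * t) (M22 x y) + scale (t * t * t) (M31 y x) = 0"
  using M_polarized[of x "scale t y"]
  by (simp add: M31_def M22_def M_scale scale_right_distrib mult.assoc)

text \<open>Replacing \<open>y\<close> by \<open>- y\<close> separates even from odd
  degrees.\<close>

lemma M22_eq_0: "M22 x y = 0"
  and M31_swap: "M31 y x = - M31 x y"
proof -
  have 1: "M31 x y + M22 x y + M31 y x = 0"
    by (rule M_polarized)
  have 2: "- M31 x y + M22 x y - M31 y x = 0"
    using M_polarized_scale[of "-1" x y] by simp
  have "(M31 x y + M22 x y + M31 y x) + (- M31 x y + M22 x y - M31 y x) = M22 x y + M22 x y"
    by simp
  then have "M22 x y + M22 x y = 0"
    unfolding 1 2 by simp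
  then show "M22 x y = 0" by (rule double_eq_0)
  then show "M31 y x = - M31 x y"
    using 1 by (simp add: add_eq_0_iff)
qed

text \<open>The two odd components scale by \<open>t\<close> and \<open>t * t * t\<close>, which
  differ for such \<open>t\<close>.\<close>

lemma M31_eq_0:
  assumes "t \<noteq> (0::'f)" "t \<noteq> 1" "t \<noteq> -1"
  shows "M31 x y = 0"
proof -
  have "scale (t - t * t * t) (M31 x y) = 0"
    using M_polarized_scale[of t x y]
    by (simp add: M22_eq_0 M31_swap[of y x] scale_left_diff_distrib)
  moreover have "t - t * t * t = t * (1 - t) * (1 + t)"
    by (simp add: algebra_simps)
  ultimately show ?thesis
    using assms by (simp add: eq_neg_iff_add_eq_0 add.commute)
qed

lemma M31_e:
  "M31 e y = (S (S y) - S y - S y - S (S (S y) - S y - S y))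
     + (S (S y) - S y - S y - S (S (S y) - S y - S y))"
  by (simp add: M31_def M_def e_e prod_additive prod_commute)

lemma S_cubic:
  assumes "t \<noteq> (0::'f)" "t \<noteq> 1" "t \<noteq> -1"
  shows "S (S (S y) - S y - S y) = S (S y) - S y - S y"
  using M31_e[of y] M31_eq_0[OF assms, of e y] double_eq_0 by (metis right_minus_eq)

end

section \<open>Characteristic three\<close>

locale char3_quartic_algebra = comm_quartic_algebra scale prod e
  for scale :: "'f::field \<Rightarrow> 'a::ab_group_add \<Rightarrow> 'a" and prod (infixl "\<odot>" 70) and e +
  assumes char3: "(1 + 1 + 1 :: 'f) = 0"
begin

lemma triple_eq_0: "x + (x + x) = (0 :: 'a)"
proof -
  have "scale (1 + 1 + 1) x = 0" by (simp only: char3 scale_zero_left)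
  then show ?thesis by (simp only: scale_left_distrib scale_one add.assoc)
qed

lemma triple_cancel_left: "x + (x + (x + y)) = (y :: 'a)"
  by (metis add.assoc add_0 triple_eq_0)

lemma uminus_eq_double: "- x = (x + x :: 'a)"
  by (metis minus_unique triple_eq_0)

lemma diff_eq_add_double: "x - y = (x + (y + y) :: 'a)"
  by (metis uminus_eq_double diff_conv_add_uminus)

lemmas sum_normalize = uminus_eq_double diff_eq_add_double triple_eq_0 triple_cancel_left
  add.assoc add.commute add.left_commute

text \<open>The failure \<open>\<Delta>\<close> of \<open>S\<close> to be a derivation satisfies \<open>\<Delta>\<^sup>2 = \<Delta>\<close>, so the product splits
  into the eigencomponents \<open>m0\<close> and \<open>m1\<close> of \<open>\<Delta>\<close>.\<close>

definition m1 where "m1 y w = S (y \<odot> w) - S y \<odot> w - y \<odot> S w"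
definition m0 where "m0 y w = y \<odot> w - m1 y w"

lemma m_additive:
  "m1 (x + y) w = m1 x w + m1 y w" "m1 w (x + y) = m1 w x + m1 w y"
  "m0 (x + y) w = m0 x w + m0 y w" "m0 w (x + y) = m0 w x + m0 w y"
  by (simp_all add: m0_def m1_def prod_additive)

lemma m_commute: "m1 y w = m1 w y" "m0 y w = m0 w y"
  by (simp_all add: m0_def m1_def prod_commute)

text \<open>The polarization of \<open>M22 e\<close>, which is quadratic in its second
  argument.\<close>

lemma S_m1: "S (m1 y w) = m1 (S y) w + m1 y (S w) + m1 y w"
proof -
  have "S (m1 y w) - (m1 (S y) w + m1 y (S w) + m1 y w) = M22 e (y + w) - M22 e y - M22 e w"
    by (simp add: M22_def M_def m1_def e_e prod_additive prod_commute sum_normalize)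
  then show ?thesis by (simp add: M22_eq_0)
qed

lemma S_m0: "S (m0 y w) = m0 (S y) w + m0 y (S w)"
  by (simp add: m0_def prod_additive S_m1) (simp add: m1_def)

text \<open>\<open>C\<close> is a cubic form that turns out to be additive, so its polarization vanishes
  and \<open>S\<close> acts on it only through the weight of \<open>m1\<close>.\<close>

definition C where "C y = m1 y (m0 y y) - m0 y (m1 y y)"

text \<open>\<open>M31_swap\<close> identifies the cubic form \<open>- M31 y e\<close> with
  \<open>M31 e y\<close>, which is additive in \<open>y\<close>.\<close>

lemma C_eq: "C y = S (S (S y)) - S y"
proof -
  have "C y = - M31 y e"
    by (simp add: M31_def M_def C_def m0_def m1_def prod_additive prod_commute sum_normalize)
  also have "\<dots> = M31 e y"
    using M31_swap[of e y] by simp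
  also have "\<dots> = S (S (S y)) - S y"
    by (simp add: M31_e prod_additive sum_normalize)
  finally show ?thesis .
qed

text \<open>The difference \<open>C (y + w) - C (y - w)\<close> keeps the parts odd in
  \<open>w\<close>; additivity of \<open>C\<close> leaves only the cubic one.\<close>

lemma C_linear_part: "m1 w (m0 y y) + m1 y (m0 y w) + m1 y (m0 y w)
   - m0 w (m1 y y) - m0 y (m1 y w) - m0 y (m1 y w) = 0" (is "?c = 0")
proof -
  have "C (y + w) - C (y - w) = C w + C w"
    by (simp add: C_eq prod_additive)
  moreover have "C (y + w) - C (y - w) = C w + C w + (?c + ?c)"
    by (simp add: C_def m_additive m_commute sum_normalize)
  ultimately have "?c + ?c = 0"
    by (metis add_cancel_right_right)
  then show ?thesis
    by (rule double_eq_0)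
qed

text \<open>Each term of \<open>C\<close> contains \<open>m1\<close> once, which contributes
  \<open>C y\<close>; the derivation part is \<open>C_linear_part\<close> at
  \<open>w = S y\<close>.\<close>

lemma S_C: "S (C y) = C y"
proof -
  have "S (C y) = C y + (m1 (S y) (m0 y y) + m1 y (m0 y (S y)) + m1 y (m0 y (S y))
     - m0 (S y) (m1 y y) - m0 y (m1 y (S y)) - m0 y (m1 y (S y)))"
    by (simp add: C_def prod_additive S_m0 S_m1 m_additive m_commute)
  then show ?thesis by (simp only: C_linear_part add_0_right)
qed

lemma S_quartic: "S (S (S (S y)) - S y) = S (S (S y)) - S y"
  using S_C by (simp only: C_eq)

end

section \<open>Algebraic power-associative algebras without zero divisors\<close>

lemma (in vector_space) finite_span:
  assumes "finite (UNIV :: 'a set)" "finite B"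
  shows "finite (span B)"
  using assms(2)
proof (induction B rule: finite_induct)
  case empty
  show ?case by simp
next
  case (insert b B)
  have "span (insert b B) \<subseteq> (\<lambda>(k, v). v + scale k b) ` (UNIV \<times> span B)"
  proof
    fix x assume "x \<in> span (insert b B)"
    then obtain k where "x - scale k b \<in> span B"
      by (auto simp: span_insert)
    then show "x \<in> (\<lambda>(k, v). v + scale k b) ` (UNIV \<times> span B)"
      by (intro image_eqI[of _ _ "(k, x - scale k b)"]) auto
  qed
  then show ?case
    using insert.IH assms(1) by (meson finite_SigmaI finite_imageI finite_subset)
qed

locale algebraic_domain = vector_space sc
  for sc :: "'f::field \<Rightarrow> 'a::ab_group_add \<Rightarrow> 'a" +
  fixes mul :: "'a \<Rightarrow> 'a \<Rightarrow> 'a" (infixl "\<odot>" 70)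
  assumes bilinear: "bilinear_prod sc mul"
    and power_assoc: "power_associative sc mul"
    and algebraic: "algebraic_alg sc mul"
    and no_zero_div: "no_zero_divisors_alg mul"
begin

abbreviation gen where "gen \<equiv> gen_subalg sc mul"

lemma mul_add_left: "(x + y) \<odot> z = x \<odot> z + y \<odot> z"
  and mul_add_right: "x \<odot> (y + z) = x \<odot> y + x \<odot> z"
  and mul_scale_left: "sc c x \<odot> y = sc c (x \<odot> y)"
  and mul_scale_right: "x \<odot> sc c y = sc c (x \<odot> y)"
  using bilinear by (auto simp: bilinear_prod_def)

lemma mul_0_left [simp]: "0 \<odot> x = 0" and mul_0_right [simp]: "x \<odot> 0 = 0"
  using mul_scale_left[of 0 0 x] mul_scale_right[of x 0 0] by simp_all

lemma mul_diff_left: "(x - y) \<odot> z = x \<odot> z - y \<odot> z"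
  by (metis add_diff_cancel diff_add_cancel mul_add_left)

lemma mul_diff_right: "x \<odot> (y - z) = x \<odot> y - x \<odot> z"
  by (metis add_diff_cancel diff_add_cancel mul_add_right)

lemma mul_sum_right: "x \<odot> sum g I = (\<Sum>i\<in>I. x \<odot> g i)"
  by (induction I rule: infinite_finite_induct) (simp_all add: mul_add_right)

lemma mul_eq_0: "x \<odot> y = 0 \<Longrightarrow> x = 0 \<or> y = 0"
  using no_zero_div by (simp add: no_zero_divisors_alg_def)

lemma mul_right_cancel: "y \<odot> x = z \<odot> x \<Longrightarrow> x \<noteq> 0 \<Longrightarrow> y = z"
  using mul_eq_0[of "y - z" x] by (simp add: mul_diff_left)

lemma gen_self: "x \<in> gen x"
  by (simp add: gen_subalg_def)

lemma gen_mul: "a \<in> gen x \<Longrightarrow> b \<in> gen x \<Longrightarrow> a \<odot> b \<in> gen x"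
  by (simp add: gen_subalg_def)

lemma subspace_gen: "subspace (gen x)"
  unfolding gen_subalg_def by (rule subspace_Inter) auto

lemma gen_subset:
  assumes "x \<in> T" "subspace T" "\<And>a b. a \<in> T \<Longrightarrow> b \<in> T \<Longrightarrow> a \<odot> b \<in> T"
  shows "gen x \<subseteq> T"
  using assms unfolding gen_subalg_def by blast

lemma gen_assoc:
  "a \<in> gen x \<Longrightarrow> b \<in> gen x \<Longrightarrow> c \<in> gen x \<Longrightarrow> a \<odot> b \<odot> c = a \<odot> (b \<odot> c)"
  using power_assoc unfolding power_associative_def by blast

lemma gen_subset_centralizer:
  assumes "b \<in> gen x" "b \<odot> x = x \<odot> b"
  shows "gen x \<subseteq> {a \<in> gen x. b \<odot> a = a \<odot> b}"
proof (rule gen_subset)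
  show "x \<in> {a \<in> gen x. b \<odot> a = a \<odot> b}"
    using assms gen_self by simp
  show "subspace {a \<in> gen x. b \<odot> a = a \<odot> b}"
    using subspace_gen[of x]
    by (auto simp: subspace_def mul_add_left mul_add_right mul_scale_left mul_scale_right)
next
  fix c d
  assume *: "c \<in> {a \<in> gen x. b \<odot> a = a \<odot> b}" "d \<in> {a \<in> gen x. b \<odot> a = a \<odot> b}"
  then have "b \<odot> (c \<odot> d) = c \<odot> b \<odot> d"
    using assms(1) gen_assoc[of b x c d] by simp
  also have "\<dots> = c \<odot> d \<odot> b"
    using * assms(1) gen_assoc[of c x b d] gen_assoc[of c x d b] by simp
  finally have "b \<odot> (c \<odot> d) = c \<odot> d \<odot> b" .
  then show "c \<odot> d \<in> {a \<in> gen x. b \<odot> a = a \<odot> b}"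
    using * gen_mul by simp
qed

lemma gen_commute:
  assumes "a \<in> gen x" "b \<in> gen x"
  shows "a \<odot> b = b \<odot> a"
proof -
  have "x \<odot> b = b \<odot> x"
    using gen_subset_centralizer[OF gen_self refl] assms(2) by blast
  then show ?thesis
    using gen_subset_centralizer[of b x] assms by auto
qed

section \<open>Powers and units\<close>

abbreviation pow where "pow \<equiv> napow mul"

lemma pow_in_gen: "pow x n \<in> gen x"
  by (induction n) (simp_all add: gen_self gen_mul)

lemma pow_mul_pow: "pow x m \<odot> pow x n = pow x (Suc (m + n))"
proof (induction m)
  case (Suc m)
  have "x \<odot> pow x m \<odot> pow x n = x \<odot> (pow x m \<odot> pow x n)"
    by (rule gen_assoc) (rule gen_self pow_in_gen)+
  then show ?case using Suc by simp
qed simp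

lemma pow_neq_0: "x \<noteq> 0 \<Longrightarrow> pow x n \<noteq> 0"
  by (induction n) (auto dest: mul_eq_0)

lemma algebraicE:
  obtains p where "p \<noteq> 0" "coeff p 0 = 0"
    "(\<Sum>i\<in>{1..degree p}. sc (coeff p i) (pow x (i - 1))) = 0"
  using algebraic unfolding algebraic_alg_def peval_def by blast

text \<open>With \<open>c\<close> the lowest nonzero coefficient, at degree \<open>n\<close>, the
  relation reads \<open>c x^n + x^n h = 0\<close>. Cancelling \<open>x^n\<close> makes
  \<open>- h / c\<close> a unit. Note that \<open>pow x (n - 1)\<close> is
  \<open>x^n\<close>.\<close>

lemma gen_unit:
  assumes "x \<noteq> 0"
  obtains g where "g \<in> gen x" "\<And>u. u \<in> gen x \<Longrightarrow> g \<odot> u = u" "\<And>u. u \<in> gen x \<Longrightarrow> u \<odot> g = u"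
proof -
  obtain p where p: "p \<noteq> 0" "coeff p 0 = 0"
    "(\<Sum>i\<in>{1..degree p}. sc (coeff p i) (pow x (i - 1))) = 0"
    by (rule algebraicE)
  define d where "d = degree p"
  define n where "n = (LEAST i. coeff p i \<noteq> 0)"
  have cn: "coeff p n \<noteq> 0"
    unfolding n_def using leading_coeff_neq_0[OF p(1)] by (rule LeastI)
  have low: "coeff p i = 0" if "i < n" for i
    using not_less_Least that unfolding n_def by blast
  have n1: "1 \<le> n"
    using cn p(2) by (cases n) auto
  have nd: "n \<le> d"
    using cn unfolding d_def by (rule le_degree)
  define h where "h = (\<Sum>i\<in>{n<..d}. sc (coeff p i) (pow x (i - n - 1)))"
  have h: "h \<in> gen x"
    unfolding h_def
    by (intro subspace_sum subspace_gen subspace_scale pow_in_gen)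
  have "pow x (n - 1) \<odot> h = (\<Sum>i\<in>{n<..d}. sc (coeff p i) (pow x (i - 1)))"
    unfolding h_def mul_sum_right mul_scale_right pow_mul_pow using n1
    by (intro sum.cong refl arg_cong[of _ _ "\<lambda>j. sc _ (pow x j)"]) (simp, arith)
  moreover have "0 = (\<Sum>i\<in>{n..d}. sc (coeff p i) (pow x (i - 1)))"
    unfolding p(3)[symmetric] d_def[symmetric]
    using n1 low by (intro sum.mono_neutral_right) auto
  moreover have "{n..d} = insert n {n<..d}"
    using nd by auto
  ultimately have h_eq: "sc (coeff p n) (pow x (n - 1)) + pow x (n - 1) \<odot> h = 0"
    by simp
  have hu: "h \<odot> u = - sc (coeff p n) u" if "u \<in> gen x" for u
  proof -
    have "pow x (n - 1) \<odot> (sc (coeff p n) u + h \<odot> u)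
        = (sc (coeff p n) (pow x (n - 1)) + pow x (n - 1) \<odot> h) \<odot> u"
      using that h
      by (simp add: mul_add_left mul_add_right mul_scale_left mul_scale_right gen_assoc[of _ x] pow_in_gen)
    then have "sc (coeff p n) u + h \<odot> u = 0"
      using h_eq mul_eq_0 pow_neq_0[OF assms] by fastforce
    then show ?thesis by (simp add: add_eq_0_iff)
  qed
  define g where "g = sc (- inverse (coeff p n)) h"
  have "g \<in> gen x"
    unfolding g_def using h by (intro subspace_scale subspace_gen)
  moreover have "g \<odot> u = u" if "u \<in> gen x" for u
    unfolding g_def mul_scale_left hu[OF that] using cn by simp
  ultimately show thesis
    using that gen_commute by metis
qed

definition acomm where "acomm x y = x \<odot> y + y \<odot> x"

text \<open>The units of the fields generated by \<open>y\<close> and by \<open>e + y\<close> agree because both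
  fields contain \<open>y\<^sup>2 = (e + y)\<^sup>2 - (e + y)\<close>.\<close>

lemma acomm_no_fixed_point:
  assumes e: "e \<odot> e = e" "e \<noteq> 0" and y: "acomm e y = y"
  shows "y = 0"
proof (rule ccontr)
  assume "y \<noteq> 0"
  define x where "x = e + y"
  have "x \<noteq> 0"
  proof
    assume "x = 0"
    then have "y = sc (-1) e"
      by (simp add: x_def add_eq_0_iff)
    then show False
      using y e unfolding acomm_def by (simp only: mul_scale_left mul_scale_right) simp
  qed
  obtain f where f: "\<And>u. u \<in> gen y \<Longrightarrow> f \<odot> u = u" "\<And>u. u \<in> gen y \<Longrightarrow> u \<odot> f = u"
    using gen_unit[OF \<open>y \<noteq> 0\<close>] by metis
  obtain g where g: "\<And>u. u \<in> gen x \<Longrightarrow> g \<odot> u = u"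
    using gen_unit[OF \<open>x \<noteq> 0\<close>] by metis
  have "x \<odot> x = e \<odot> e + acomm e y + y \<odot> y"
    by (simp add: x_def acomm_def mul_add_left mul_add_right ac_simps)
  then have "y \<odot> y = x \<odot> x - x"
    by (simp add: x_def y e)
  then have "y \<odot> y \<in> gen x"
    by (simp add: subspace_diff subspace_gen gen_mul gen_self)
  then have "g \<odot> (y \<odot> y) = f \<odot> (y \<odot> y)"
    by (simp add: f g gen_mul gen_self)
  moreover have "y \<odot> y \<noteq> 0"
    using mul_eq_0 \<open>y \<noteq> 0\<close> by blast
  ultimately have "g = f"
    by (rule mul_right_cancel)
  \<comment> \<open>The common unit fixes \<open>y\<close> and \<open>e + y\<close>, hence
    \<open>e\<close>, so it equals \<open>e\<close>; then \<open>acomm e y = y + y\<close>.\<close>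
  then have "g \<odot> y = y" "y \<odot> g = y"
    using f gen_self by auto
  moreover have "g \<odot> x = x"
    by (simp add: g gen_self)
  ultimately have "g \<odot> e = e \<odot> e"
    by (simp add: x_def mul_add_right e)
  then have "g = e"
    using e(2) by (rule mul_right_cancel)
  then show False
    using y \<open>g \<odot> y = y\<close> \<open>y \<odot> g = y\<close> \<open>y \<noteq> 0\<close> by (simp add: acomm_def)
qed

text \<open>The relation puts the top power in the span of the lower ones; this finite span is then
  stable under multiplication by \<open>x\<close>.\<close>

lemma finite_range_pow:
  assumes "finite (UNIV :: 'f set)"
  shows "finite (range (pow x))"
proof -
  obtain p where p: "p \<noteq> 0" "coeff p 0 = 0"
    "(\<Sum>i\<in>{1..degree p}. sc (coeff p i) (pow x (i - 1))) = 0"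
    by (rule algebraicE)
  have "degree p \<noteq> 0"
    using p by (metis leading_coeff_0_iff)
  then obtain d where d: "degree p = Suc d"
    by (cases "degree p") auto
  define H where "H = span (pow x ` {..<d})"
  have fin: "finite H"
    unfolding H_def by (rule finite_span) (simp_all add: assms)
  have low: "pow x i \<in> H" if "i < d" for i
    unfolding H_def using that by (intro span_base) simp
  have "(\<Sum>i\<in>{1..Suc d}. sc (coeff p i) (pow x (i - 1)))
      = (\<Sum>i\<in>{1..d}. sc (coeff p i) (pow x (i - 1))) + sc (coeff p (Suc d)) (pow x d)"
    by simp
  then have "sc (coeff p (Suc d)) (pow x d) = - (\<Sum>i\<in>{1..d}. sc (coeff p i) (pow x (i - 1)))"
    using p(3) d by (simp add: add_eq_0_iff)
  moreover have "(\<Sum>i\<in>{1..d}. sc (coeff p i) (pow x (i - 1))) \<in> H"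
    using low unfolding H_def by (intro span_sum span_scale) auto
  ultimately have "sc (coeff p (Suc d)) (pow x d) \<in> H"
    unfolding H_def by (simp add: span_neg)
  then have "sc (inverse (coeff p (Suc d))) (sc (coeff p (Suc d)) (pow x d)) \<in> H"
    unfolding H_def by (rule span_scale)
  moreover have "coeff p (Suc d) \<noteq> 0"
    using p(1) d by (metis leading_coeff_0_iff)
  ultimately have top: "pow x d \<in> H"
    by simp
  have step: "x \<odot> h \<in> H" if "h \<in> H" for h
    using that unfolding H_def
  proof (induction rule: span_induct_alt)
    case base
    show ?case by (simp add: span_zero)
  next
    case (step c b h)
    then obtain i where i: "i < d" "b = pow x i" by auto
    then have "x \<odot> b \<in> H"
      using low[of "Suc i"] top by (cases "Suc i = d") auto
    then show ?case
      using step by (simp add: H_def mul_add_right mul_scale_right span_add span_scale)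
  qed
  have "pow x n \<in> H" for n
  proof (induction n)
    case 0
    show ?case using low[of 0] top by (cases "d = 0") auto
  qed (simp add: step)
  then show ?thesis
    using fin by (meson finite_subset image_subsetI)
qed

lemma iterated_square_in_gen: "((\<lambda>x. x \<odot> x) ^^ k) x \<in> gen x"
  by (induction k) (simp_all add: gen_self gen_mul)

lemma add_self_of_char2:
  assumes "(1 + 1 :: 'f) = 0"
  shows "x + x = (0::'a)"
  using scale_left_distrib[of 1 1 x] assms by simp

text \<open>The iterates form a finite set, and squaring is injective on \<open>gen x\<close>, so
  the preperiod can be cancelled.\<close>

lemma iterated_square_periodic:
  assumes char2: "(1 + 1 :: 'f) = 0" and fin: "finite (UNIV :: 'f set)"
  obtains m where "0 < m" "((\<lambda>x. x \<odot> x) ^^ m) x = x"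
proof -
  let ?q = "\<lambda>x. x \<odot> x"
  have "\<exists>n. (?q ^^ k) x = pow x n" for k
  proof (induction k)
    case 0
    show ?case by (intro exI[of _ 0]) simp
  next
    case (Suc k)
    then obtain n where "(?q ^^ k) x = pow x n" by blast
    then have "(?q ^^ Suc k) x = pow x (Suc (n + n))"
      by (simp only: funpow.simps o_def pow_mul_pow)
    then show ?case by blast
  qed
  then have "range (\<lambda>k. (?q ^^ k) x) \<subseteq> range (pow x)"
    by blast
  then have "finite (range (\<lambda>k. (?q ^^ k) x))"
    using finite_range_pow[OF fin] finite_subset by blast
  then have "\<not> inj (\<lambda>k. (?q ^^ k) x)"
    using finite_imageD infinite_UNIV_nat by blast
  then obtain i j where "i < j" "(?q ^^ i) x = (?q ^^ j) x"
    by (metis (mono_tags, lifting) injI linorder_neqE_nat)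
  then have eq: "(?q ^^ i) x = (?q ^^ (i + (j - i))) x" and pos: "0 < j - i"
    by simp_all
  have inj: "a = b" if "a \<in> gen x" "b \<in> gen x" "a \<odot> a = b \<odot> b" for a b
  proof -
    have "(a - b) \<odot> (a - b) = (a \<odot> a - a \<odot> b) + (a \<odot> a - a \<odot> b)"
      using gen_commute[OF that(1,2)] that(3) by (simp add: mul_diff_left mul_diff_right)
    then have "(a - b) \<odot> (a - b) = 0"
      by (simp only: add_self_of_char2[OF char2])
    then show ?thesis
      using mul_eq_0 by fastforce
  qed
  have "(?q ^^ i) x = (?q ^^ (i + m)) x \<Longrightarrow> (?q ^^ m) x = x" for m
  proof (induction i)
    case (Suc i)
    then show ?case
      using inj[OF iterated_square_in_gen iterated_square_in_gen, of i "i + m"] by simp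
  qed simp
  then show thesis
    using that eq pos by blast
qed

lemma char2_squaring_acomm:
  assumes char2: "(1 + 1 :: 'f) = 0"
  shows "char2_squaring acomm (\<lambda>x. x \<odot> x)"
proof
  show "x + x = (0::'a)" for x
    by (rule add_self_of_char2[OF char2])
  then show "acomm x x = 0" for x
    by (simp add: acomm_def)
  show "acomm (((\<lambda>x. x \<odot> x) ^^ k) x) x = 0" for k x
    unfolding acomm_def using gen_commute[OF iterated_square_in_gen[of k x] gen_self]
    by (simp add: add_self_of_char2[OF char2])
qed (simp_all add: acomm_def mul_add_left mul_add_right ac_simps)

lemma comm_quartic_algebra_acomm:
  assumes "(1 + 1 :: 'f) \<noteq> 0" "e \<odot> e = e"
  shows "comm_quartic_algebra sc acomm e"
proof
  fix x
  have "x \<odot> x \<odot> x = x \<odot> (x \<odot> x)" "x \<odot> x \<odot> (x \<odot> x) = x \<odot> (x \<odot> (x \<odot> x))"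
    "x \<odot> (x \<odot> x) \<odot> x = x \<odot> (x \<odot> (x \<odot> x))"
    by (simp_all add: gen_assoc[of _ x] gen_mul gen_self)
  then show "acomm (acomm x x) (acomm x x) = acomm x (acomm x (acomm x x))"
    by (simp add: acomm_def mul_add_left mul_add_right)
  show "(1 + 1 :: 'f) \<noteq> 0" by fact
qed (simp_all add: assms(2) acomm_def mul_add_left mul_add_right mul_scale_left mul_scale_right
    scale_right_distrib ac_simps)

end

section \<open>Rota--Baxter operators of weight zero\<close>

text \<open>The data obtained from a nonzero operator; the goal is \<open>False\<close>.\<close>

locale weight_zero_rota_baxter = algebraic_domain sc mul
  for sc :: "'f::field \<Rightarrow> 'a::ab_group_add \<Rightarrow> 'a" and mul (infixl "\<odot>" 70) +
  fixes R :: "'a \<Rightarrow> 'a" and a e :: 'a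
  assumes R_linear: "Vector_Spaces.linear sc sc R"
    and R_mul: "R x \<odot> R y = R (R x \<odot> y + x \<odot> R y)"
    and R_a: "R a = e"
    and e_e: "e \<odot> e = e"
    and e_neq_0: "e \<noteq> 0"
begin

interpretation R: Vector_Spaces.linear sc sc R by (rule R_linear)

text \<open>The kernel of \<open>R\<close> is stable under \<open>acomm e\<close>, and
  \<open>x\<close> differs from \<open>sc t a\<close> by a kernel element.\<close>

lemma R_acomm:
  assumes "R x = sc t e"
  shows "R (acomm e x) = sc t e"
proof -
  define k where "k = x - sc t a"
  have "R k = 0"
    by (simp add: k_def R.diff R.scale R_a assms)
  then have "R (acomm e k) = 0"
    using R_mul[of a k] R_mul[of k a] by (simp add: acomm_def R.add R_a R.zero)
  moreover have "x = k + sc t a"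
    by (simp add: k_def)
  then have "acomm e x = acomm e k + sc t (acomm e a)"
    by (simp add: acomm_def mul_add_left mul_add_right mul_scale_left mul_scale_right
        scale_right_distrib ac_simps)
  moreover have "R (acomm e a) = e"
    using R_mul[of a a] by (simp add: acomm_def R_a e_e)
  ultimately show ?thesis
    by (simp add: R.add R.scale)
qed

lemma R_acomm_a: "R (acomm e a) = e" and R_acomm_acomm_a: "R (acomm e (acomm e a)) = e"
  using R_acomm[of a 1] R_acomm[of "acomm e a" 1] by (simp_all add: R_a)

text \<open>\<open>defect\<close> is symmetric, but a scalar \<open>t\<close> leaves its first
  argument as \<open>t * t\<close> and its second as \<open>t\<close>.\<close>

lemma False_if_char2_not_F2:
  assumes "(1 + 1 :: 'f) = 0" "t \<noteq> (0::'f)" "t \<noteq> 1"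
  shows False
proof -
  interpret sq: char2_squaring acomm "\<lambda>x. x \<odot> x"
    by (rule char2_squaring_acomm) fact
  interpret sq: char2_squaring_idem acomm "\<lambda>x. x \<odot> x" e
    by unfold_locales (rule e_e)
  have scale_acomm: "acomm (sc c x) y = sc c (acomm x y)" "acomm x (sc c y) = sc c (acomm x y)" for c x y
    by (simp_all add: acomm_def mul_scale_left mul_scale_right scale_right_distrib)
  have "sq.defect e (sc t a) = sc t (sq.defect e a)" "sq.defect (sc t a) e = sc (t * t) (sq.defect a e)"
    by (simp_all add: sq.defect_def scale_acomm mul_scale_left mul_scale_right scale_right_distrib)
  then have "sc t (sq.defect e a) = sc (t * t) (sq.defect e a)"
    by (metis sq.defect_commute)
  then have "sq.defect e a = 0"
    using assms by simp
  then have "acomm e (acomm e a) = acomm e a"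
    by (metis sq.defect_e sq.eq_iff_add_eq_0)
  then have "acomm e a = 0"
    by (rule acomm_no_fixed_point[OF e_e e_neq_0])
  then show False
    using R_acomm_a e_neq_0 by (simp add: R.zero)
qed

text \<open>\<open>R\<close> sends \<open>z\<close> to \<open>e\<close> but
  \<open>(S + 1)^m z\<close> to \<open>2^m e = 0\<close>, as \<open>m > 0\<close>; applying
  \<open>S\<close> twice preserves these values and makes the arguments equal.\<close>

lemma False_if_F2:
  assumes char2: "(1 + 1 :: 'f) = 0" and F2: "\<And>t :: 'f. t = 0 \<or> t = 1"
  shows False
proof -
  interpret sq: char2_squaring acomm "\<lambda>x. x \<odot> x"
    by (rule char2_squaring_acomm) fact
  interpret sq: char2_squaring_idem acomm "\<lambda>x. x \<odot> x" e
    by unfold_locales (rule e_e)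
  have "(UNIV :: 'f set) = {0, 1}"
    using F2 by auto
  then have fin: "finite (UNIV :: 'f set)"
    by (metis finite.emptyI finite.insertI)
  define z where "z = acomm e (acomm e a)"
  obtain m where m: "0 < m" "((\<lambda>x. x \<odot> x) ^^ m) z = z"
    by (rule iterated_square_periodic[OF char2 fin])
  have step: "R (acomm e x + x) = sc (t + t) e" if "R x = sc t e" for x t
    by (simp only: R.add R_acomm[OF that] that scale_left_distrib)
  have "\<exists>t. R (((\<lambda>x. acomm e x + x) ^^ k) z) = sc t e" for k
  proof (induction k)
    case 0
    show ?case by (intro exI[of _ 1]) (simp add: z_def R_acomm_acomm_a)
  next
    case (Suc k)
    then obtain t where "R (((\<lambda>x. acomm e x + x) ^^ k) z) = sc t e" by blast
    from step[OF this] show ?case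
      by (auto simp only: funpow.simps o_apply)
  qed
  then obtain t where "R (((\<lambda>x. acomm e x + x) ^^ (m - 1)) z) = sc t e"
    by blast
  from step[OF this] have "R (((\<lambda>x. acomm e x + x) ^^ Suc (m - 1)) z) = sc (t + t) e"
    by (simp only: funpow.simps o_apply)
  then have "R (((\<lambda>x. acomm e x + x) ^^ m) z) = sc 0 e"
    using m(1) by (simp only: Suc_diff_1 scale_left_distrib sq.add_self scale_zero_left)
  then have "R (acomm e (acomm e (((\<lambda>x. acomm e x + x) ^^ m) z))) = sc 0 e"
    by (intro R_acomm)
  moreover have "R (acomm e (acomm e z)) = sc 1 e"
    unfolding z_def by (intro R_acomm) (simp add: R_a)
  ultimately show False
    using sq.S_poly_of_periodic[OF z_def m(2)] e_neq_0 by simp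
qed

lemma False_if_not_char2:
  assumes two: "(1 + 1 :: 'f) \<noteq> 0"
  shows False
proof -
  interpret qa: comm_quartic_algebra sc acomm e
    by (rule comm_quartic_algebra_acomm[OF two e_e])
  note no_fixed = acomm_no_fixed_point[OF e_e e_neq_0]
  show False
  proof (cases "\<exists>t :: 'f. t \<noteq> 0 \<and> t \<noteq> 1 \<and> t \<noteq> -1")
    case True
    then have "acomm e (acomm e a) - acomm e a - acomm e a = 0"
      using qa.S_cubic no_fixed by blast
    then have "R (acomm e (acomm e a) - acomm e a - acomm e a) = 0"
      by (simp add: R.zero)
    then show False
      using e_neq_0 by (simp add: R.diff R_acomm_a R_acomm_acomm_a)
  next
    case False
    \<comment> \<open>The only scalars are 0, 1 and -1, and \<open>1 + 1\<close> is neither 0 nor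
      1.\<close>
    then have "(1 + 1 :: 'f) = -1"
      using two by (metis add_cancel_right_right one_neq_zero)
    then interpret qa: char3_quartic_algebra sc acomm e
      by unfold_locales simp
    have "acomm e (acomm e (acomm e a)) - acomm e a = 0"
      by (rule no_fixed[OF qa.S_quartic])
    then have "acomm e (acomm e (acomm e a) + acomm e a) = acomm e (acomm e a) + acomm e a"
      by (simp add: qa.prod_add_right)
    then have "acomm e (acomm e a) + acomm e a = 0"
      by (rule no_fixed)
    then have "e + e = 0"
      using R.add[of "acomm e (acomm e a)" "acomm e a"] by (simp add: R_acomm_a R_acomm_acomm_a R.zero)
    then show False
      using qa.double_eq_0 e_neq_0 by blast
  qed
qed

lemma inconsistent: False
  using False_if_not_char2 False_if_char2_not_F2 False_if_F2 by metis

end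

theorem theorem2:
  fixes sc :: "'f::field \<Rightarrow> 'a::ab_group_add \<Rightarrow> 'a"
    and mul :: "'a \<Rightarrow> 'a \<Rightarrow> 'a"
    and R :: "'a \<Rightarrow> 'a"
  assumes "nonassoc_algebra sc mul"
    and "power_associative sc mul"
    and "algebraic_alg sc mul"
    and "no_zero_divisors_alg mul"
    and "rota_baxter sc mul 0 R"
  shows "R = (\<lambda>x. 0)"
proof (rule ccontr)
  assume "R \<noteq> (\<lambda>x. 0)"
  then obtain x where x: "R x \<noteq> 0" by auto
  interpret vector_space sc
    using assms(1) by (simp add: nonassoc_algebra_def)
  interpret algebraic_domain sc mul
    using assms by unfold_locales (simp_all add: nonassoc_algebra_def)
  interpret R: Vector_Spaces.linear sc sc R
    using assms(5) by (simp add: rota_baxter_def)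
  have R_mul: "mul (R x) (R y) = R (mul (R x) y + mul x (R y))" for x y
    using assms(5) by (simp add: rota_baxter_def)
  obtain e where e: "e \<in> gen (R x)" "\<And>u. u \<in> gen (R x) \<Longrightarrow> mul e u = u"
    using gen_unit[OF x] by metis
  have "gen (R x) \<subseteq> range R"
  proof (rule gen_subset)
    show "subspace (range R)"
      by (rule R.subspace_image) simp
  qed (auto simp: R_mul)
  then obtain a where "R a = e"
    using e(1) by auto
  moreover have "e \<noteq> 0"
    using e(2)[OF gen_self] x by auto
  ultimately interpret weight_zero_rota_baxter sc mul R a e
    using R_mul e assms(5) by unfold_locales (auto simp: rota_baxter_def)
  show False by (rule inconsistent)
qed

end
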